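(* Let $\ell_1,\dots,\ell_n:\mathbb{R}^d\to\mathbb{R}$ be continuously differentiable functions whose gradients are $L$-Lipschitz continuous ($L>0$), with $\inf_{x\in\mathbb{R}^d}\ell_i(x)>-\infty$ for every $i$. Let $\mathcal{X}_i^*$ be the set of global minimizers of $\ell_i$, and assume that $\mathcal{X}^*:=\bigcap_{i=1}^n\mathcal{X}_i^*$ is non-empty and bounded. Let $0<\eta<\frac1L$, and let $\{x_k\}_{k\ge 0}$ be the sequence generated from an initial point $x_0\in\mathbb{R}^d$ by SGD with learning rate $\eta$ and cyclic sampling with reshuffle, with sampled indices $\xi_k$. Assume that SGD follows an epochwise star-convex path for a certain $x^*\in\mathcal{X}^*$, i.e. for every epoch $B=0,1,2,\dots$, $$\sum_{k=nB}^{n(B+1)-1}\Big[\ell_{\xi_k}(x_k)-\ell_{\xi_k}(x^* )+\langle x^*-x_k,\nabla\ell_{\xi_k}(x_k)\rangle\Big]\le 0 .$$ Then, for all epochs $B=0,1,2,\dots$, $$\|x_{n(B+1)}-x^*\|\le\|x_{nB}-x^*\| .$$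
   Context: The underlying problem is $\min_{x\in\mathbb{R}^d} f(x):=\frac1n\sum_{i=1}^n\ell_i(x)$. $\|\cdot\|$ and $\langle\cdot,\cdot\rangle$ are the Euclidean norm and inner product. SGD with cyclic sampling with reshuffle: for each epoch $B=0,1,2,\dots$, $\pi_B$ is a (randomly drawn) permutation of $\{1,\dots,n\}$. Every iteration index is written $k=nB+t$ with $B\ge 0$ and $t\in\{0,\dots,n-1\}$, the sampled index is $\xi_k=\pi_B(t+1)$, and the update is $x_{k+1}=x_k-\eta\nabla\ell_{\xi_k}(x_k)$ for $k=0,1,2,\dots$. The hypothesis and the conclusion both concern the realized path, for the realized sequence of permutations. *)

theory Defs
  imports "HOL-Analysis.Analysis"
begin

text \<open>Only meaningful at points where \<open>f\<close> is differentiable.\<close>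

definition grad :: "('a::euclidean_space \<Rightarrow> real) \<Rightarrow> 'a \<Rightarrow> 'a" where
  "grad f x = (THE D. GDERIV f x :> D)"

definition continuously_differentiable :: "('a::euclidean_space \<Rightarrow> real) \<Rightarrow> bool" where
  "continuously_differentiable f \<longleftrightarrow>
     (\<forall>x. f differentiable (at x)) \<and> continuous_on UNIV (grad f)"

definition global_minimizers :: "('a \<Rightarrow> real) \<Rightarrow> 'a set" where
  "global_minimizers f = {x. is_arg_min f (\<lambda>_. True) x}"

text \<open>
  \<open>\<pi> B\<close> is the realized permutation of epoch \<open>B\<close>; epoch \<open>B\<close> consists of the iterations
  \<open>n * B, \<dots>, n * (B + 1) - 1\<close>. Since every sequence of permutations is admitted, no
  probability space is needed for statements about a realized path.
\<close>

definition cyclic_reshuffle :: "nat \<Rightarrow> (nat \<Rightarrow> nat \<Rightarrow> nat) \<Rightarrow> (nat \<Rightarrow> nat) \<Rightarrow> bool" where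
  "cyclic_reshuffle n \<pi> \<xi> \<longleftrightarrow>
     (\<forall>B. \<pi> B permutes {1..n}) \<and> (\<forall>B. \<forall>t<n. \<xi> (n * B + t) = \<pi> B (t + 1))"

primrec sgd ::
  "(nat \<Rightarrow> 'a::euclidean_space \<Rightarrow> real) \<Rightarrow> real \<Rightarrow> (nat \<Rightarrow> nat) \<Rightarrow> 'a \<Rightarrow> nat \<Rightarrow> 'a" where
  "sgd l \<eta> \<xi> x0 0 = x0"
| "sgd l \<eta> \<xi> x0 (Suc k) =
     sgd l \<eta> \<xi> x0 k - \<eta> *\<^sub>R grad (l (\<xi> k)) (sgd l \<eta> \<xi> x0 k)"

definition epochwise_star_convex_path ::
  "nat \<Rightarrow> (nat \<Rightarrow> 'a::euclidean_space \<Rightarrow> real) \<Rightarrow> (nat \<Rightarrow> nat) \<Rightarrow> (nat \<Rightarrow> 'a) \<Rightarrow> 'a \<Rightarrow> bool" where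
  "epochwise_star_convex_path n l \<xi> x xstar \<longleftrightarrow>
     (\<forall>B. (\<Sum>k = n * B..<n * (B + 1).
        l (\<xi> k) (x k) - l (\<xi> k) xstar
          + (xstar - x k) \<bullet> grad (l (\<xi> k)) (x k)) \<le> 0)"

end

(* Write z for the common minimizer. By the descent lemma each l_i satisfies
   |grad l_i(x)|^2 <= 2 L (l_i(x) - l_i(z)), so the quadratic term eta^2 |grad|^2 in the
   expansion of |x_{k+1} - z|^2 is at most 2 eta (l_i(x_k) - l_i(z)) as eta L < 1. The
   increment of |x_k - z|^2 is therefore at most 2 eta times the k-th summand of the
   star-convexity condition; sum over the epoch. *)

theory Submission
  imports Defs
begin

text \<open>Makes the \<open>THE\<close> in \<open>grad\<close> usable. Existence of the gradient
  vector is the Riesz representation of the derivative, with coordinates \<open>f' b\<close> on the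
  basis; its uniqueness comes from uniqueness of the derivative.\<close>

lemma gderiv_grad:
  fixes f :: "'a::euclidean_space \<Rightarrow> real"
  assumes "f differentiable (at x)"
  shows "GDERIV f x :> grad f x"
proof -
  obtain f' where f': "(f has_derivative f') (at x)"
    using assms unfolding differentiable_def by blast
  interpret bounded_linear f' using f' by (rule has_derivative_bounded_linear)
  have "f' h = h \<bullet> (\<Sum>b\<in>Basis. f' b *\<^sub>R b)" for h
  proof -
    have "f' h = f' (\<Sum>b\<in>Basis. (h \<bullet> b) *\<^sub>R b)"
      by (simp add: euclidean_representation)
    also have "\<dots> = (\<Sum>b\<in>Basis. (h \<bullet> b) * f' b)"
      by (simp add: sum scaleR)
    also have "\<dots> = h \<bullet> (\<Sum>b\<in>Basis. f' b *\<^sub>R b)"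
      by (simp add: inner_sum_right mult.commute)
    finally show ?thesis .
  qed
  then have "f' = (\<lambda>h. h \<bullet> (\<Sum>b\<in>Basis. f' b *\<^sub>R b))"
    by (rule ext)
  with f' have *: "GDERIV f x :> (\<Sum>b\<in>Basis. f' b *\<^sub>R b)"
    unfolding gderiv_def by simp
  have "D = (\<Sum>b\<in>Basis. f' b *\<^sub>R b)" if "GDERIV f x :> D" for D
  proof -
    have "(\<lambda>h. h \<bullet> D) = (\<lambda>h. h \<bullet> (\<Sum>b\<in>Basis. f' b *\<^sub>R b))"
      using that * unfolding gderiv_def by (rule has_derivative_unique)
    then show ?thesis
      by (simp only: fun_eq_iff vector_eq_ldot)
  qed
  then show ?thesis
    unfolding grad_def by (rule theI[where P = "\<lambda>D. GDERIV f x :> D", OF *])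
qed

text \<open>Follows from monotonicity along the segment from \<open>x\<close> to
  \<open>x + v\<close>: the Lipschitz bound controls how fast the slope can grow, so no integral is
  required.\<close>

lemma descent_lemma:
  fixes f :: "'a::euclidean_space \<Rightarrow> real"
  assumes diff: "\<And>y. f differentiable (at y)"
    and lip: "L-lipschitz_on UNIV (grad f)"
  shows "f (x + v) \<le> f x + v \<bullet> grad f x + L / 2 * (norm v)\<^sup>2"
proof -
  \<comment> \<open>\<open>h\<close> is \<open>f\<close> along the segment minus the linear and
    quadratic terms of the bound. Since \<open>h 0 = f x\<close>, the claim is exactly
    \<open>h 1 \<le> h 0\<close>.\<close>
  define h where "h t = f (x + t *\<^sub>R v) - t * (v \<bullet> grad f x) - L / 2 * t\<^sup>2 * (norm v)\<^sup>2" for t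
  define h' where "h' t = v \<bullet> grad f (x + t *\<^sub>R v) - v \<bullet> grad f x - L * t * (norm v)\<^sup>2" for t
  have deriv: "(h has_real_derivative h' t) (at t)" for t
  proof -
    have "(f has_derivative (\<lambda>u. u \<bullet> grad f (x + t *\<^sub>R v))) (at (x + t *\<^sub>R v))"
      using gderiv_grad[OF diff] unfolding gderiv_def .
    moreover have "((\<lambda>s. x + s *\<^sub>R v) has_derivative (\<lambda>s. s *\<^sub>R v)) (at t)"
      by (auto intro!: derivative_eq_intros)
    ultimately have "((\<lambda>s. f (x + s *\<^sub>R v)) has_derivative
        (\<lambda>s. (s *\<^sub>R v) \<bullet> grad f (x + t *\<^sub>R v))) (at t)"
      by (rule has_derivative_compose[rotated])
    then have "((\<lambda>s. f (x + s *\<^sub>R v)) has_real_derivative v \<bullet> grad f (x + t *\<^sub>R v)) (at t)"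
      by (simp add: has_field_derivative_def mult.commute[of _ "v \<bullet> _"])
    then show ?thesis
      unfolding h_def[abs_def] h'_def
      by (auto intro!: derivative_eq_intros)
  qed
  \<comment> \<open>The sign of \<open>t\<close> matters: only for nonnegative \<open>t\<close> does
    the Lipschitz estimate, which yields the norm of \<open>t *\<^sub>R v\<close>, match the term
    \<open>L * t * (norm v)\<^sup>2\<close> subtracted in \<open>h'\<close>.\<close>
  have "h' t \<le> 0" if "0 \<le> t" for t
  proof -
    have "v \<bullet> (grad f (x + t *\<^sub>R v) - grad f x)
        \<le> norm v * norm (grad f (x + t *\<^sub>R v) - grad f x)"
      by (rule norm_cauchy_schwarz)
    also have "\<dots> \<le> norm v * (L * norm (t *\<^sub>R v))"
      using lipschitz_onD[OF lip, of "x + t *\<^sub>R v" x]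
      by (intro mult_left_mono) (auto simp: dist_norm)
    finally show ?thesis
      using that by (simp add: h'_def inner_diff_right power2_eq_square algebra_simps)
  qed
  then have "h 1 \<le> h 0"
    by (intro DERIV_nonpos_imp_nonincreasing[of 0 1]) (auto intro: deriv)
  then show ?thesis
    by (simp add: h_def)
qed

lemma grad_norm_le_suboptimality:
  fixes f :: "'a::euclidean_space \<Rightarrow> real"
  assumes "\<And>y. f differentiable (at y)"
    and "L-lipschitz_on UNIV (grad f)"
    and "L > 0"
    and "z \<in> global_minimizers f"
  shows "(norm (grad f x))\<^sup>2 \<le> 2 * L * (f x - f z)"
proof -
  let ?g = "grad f x"
  \<comment> \<open>The step length \<open>1 / L\<close> minimizes the quadratic upper bound along
    the negative gradient, so it gives the largest guaranteed decrease; \<open>f z\<close> lies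
    below even that value.\<close>
  have "f z \<le> f (x + (- 1 / L) *\<^sub>R ?g)"
    using assms(4) by (auto simp: global_minimizers_def is_arg_min_linorder)
  also have "\<dots> \<le> f x + ((- 1 / L) *\<^sub>R ?g) \<bullet> ?g + L / 2 * (norm ((- 1 / L) *\<^sub>R ?g))\<^sup>2"
    by (rule descent_lemma[OF assms(1,2)])
  also have "\<dots> = f x - (norm ?g)\<^sup>2 / (2 * L)"
  proof -
    have "L / 2 * (norm ((- 1 / L) *\<^sub>R ?g))\<^sup>2 = (norm ?g)\<^sup>2 / (2 * L)"
      using \<open>L > 0\<close> by (simp add: power_divide power2_eq_square)
    \<comment> \<open>The linear term is twice the quadratic one with opposite sign. Writing it so
      leaves one common nonlinear term for \<open>linarith\<close>.\<close>
    moreover have "((- 1 / L) *\<^sub>R ?g) \<bullet> ?g = - (2 * ((norm ?g)\<^sup>2 / (2 * L)))"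
      by (simp add: dot_square_norm)
    ultimately show ?thesis
      by linarith
  qed
  finally show ?thesis
    using \<open>L > 0\<close> by (simp add: field_simps)
qed

text \<open>The right-hand side may be positive, so a single step can move away from
  \<open>z\<close>. The bound is kept in this form because it is the summand of the star-convexity
  condition, up to the factor \<open>2 * \<eta>\<close>, which does not depend on the step.\<close>

lemma gradient_step_distance:
  fixes f :: "'a::euclidean_space \<Rightarrow> real"
  assumes "\<And>y. f differentiable (at y)"
    and "L-lipschitz_on UNIV (grad f)"
    and "L > 0" and "0 \<le> \<eta>" and "\<eta> \<le> 1 / L"
    and z: "z \<in> global_minimizers f"
  shows "(norm (x - \<eta> *\<^sub>R grad f x - z))\<^sup>2 - (norm (x - z))\<^sup>2
    \<le> 2 * \<eta> * (f x - f z + (z - x) \<bullet> grad f x)"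
proof -
  let ?g = "grad f x"
  have "0 \<le> f x - f z"
    using z by (auto simp: global_minimizers_def is_arg_min_linorder)
  moreover have "\<eta> * L \<le> 1"
    using \<open>\<eta> \<le> 1 / L\<close> \<open>L > 0\<close> by (simp add: field_simps)
  ultimately have "\<eta> * L * (f x - f z) \<le> f x - f z"
    using mult_right_mono[of "\<eta> * L" 1 "f x - f z"] by simp
  have "\<eta> * (norm ?g)\<^sup>2 \<le> \<eta> * (2 * L * (f x - f z))"
    using assms(4) by (intro mult_left_mono grad_norm_le_suboptimality[OF assms(1-3) z])
  also have "\<dots> \<le> 2 * (f x - f z)"
    using \<open>\<eta> * L * (f x - f z) \<le> f x - f z\<close> by simp
  \<comment> \<open>The second factor \<open>\<eta>\<close> produces the squared step size that
    appears when the new squared distance is expanded.\<close>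
  finally have "\<eta> * (\<eta> * (norm ?g)\<^sup>2) \<le> \<eta> * (2 * (f x - f z))"
    using assms(4) by (rule mult_left_mono)
  moreover have "(norm (x - \<eta> *\<^sub>R ?g - z))\<^sup>2
      = (norm (x - z))\<^sup>2 + 2 * \<eta> * ((z - x) \<bullet> ?g) + \<eta> * (\<eta> * (norm ?g)\<^sup>2)"
    by (simp add: power2_norm_eq_inner algebra_simps inner_commute)
  ultimately show ?thesis
    by (simp add: algebra_simps)
qed

theorem theorem1:
  fixes l :: "nat \<Rightarrow> real ^ 'd \<Rightarrow> real"
    and n :: nat
    and L \<eta> :: real
    and \<pi> :: "nat \<Rightarrow> nat \<Rightarrow> nat"
    and \<xi> :: "nat \<Rightarrow> nat"
    and x :: "nat \<Rightarrow> real ^ 'd"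
    and x0 xstar :: "real ^ 'd"
  assumes "n \<ge> 1"
    and "L > 0"
    and "\<And>i. i \<in> {1..n} \<Longrightarrow> continuously_differentiable (l i)"
    and "\<And>i. i \<in> {1..n} \<Longrightarrow> L-lipschitz_on UNIV (grad (l i))"
    and "\<And>i. i \<in> {1..n} \<Longrightarrow> bdd_below (range (l i))"
    and "(\<Inter>i\<in>{1..n}. global_minimizers (l i)) \<noteq> {}"
    and "bounded (\<Inter>i\<in>{1..n}. global_minimizers (l i))"
    and "0 < \<eta>" and "\<eta> < 1 / L"
    and "cyclic_reshuffle n \<pi> \<xi>"
    and "x = sgd l \<eta> \<xi> x0"
    and "xstar \<in> (\<Inter>i\<in>{1..n}. global_minimizers (l i))"
    and "epochwise_star_convex_path n l \<xi> x xstar"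
  shows "\<forall>B. norm (x (n * (B + 1)) - xstar) \<le> norm (x (n * B) - xstar)"
proof
  fix B
  have step: "(norm (x (Suc k) - xstar))\<^sup>2 - (norm (x k - xstar))\<^sup>2
      \<le> 2 * \<eta> * (l (\<xi> k) (x k) - l (\<xi> k) xstar + (xstar - x k) \<bullet> grad (l (\<xi> k)) (x k))"
    for k
  proof -
    \<comment> \<open>Division with remainder recovers epoch and offset of \<open>k\<close>. Offsets
      start at 0 and the permuted set at 1, hence the shift by one.\<close>
    have "k mod n < n"
      using \<open>n \<ge> 1\<close> by simp
    then have "\<xi> (n * (k div n) + k mod n) = \<pi> (k div n) (k mod n + 1)"
      and "\<pi> (k div n) permutes {1..n}"
      using assms(10) unfolding cyclic_reshuffle_def by blast+
    moreover have "k mod n + 1 \<in> {1..n}"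
      using \<open>k mod n < n\<close> by simp
    ultimately have i: "\<xi> k \<in> {1..n}"
      using permutes_in_image[of "\<pi> (k div n)" "{1..n}" "k mod n + 1"]
      by (simp only: mult_div_mod_eq)
    have "l (\<xi> k) differentiable (at y)" for y
      using assms(3)[OF i] unfolding continuously_differentiable_def by blast
    \<comment> \<open>One point minimizes every component, so the reference point is the same at
      each step and the increments telescope below.\<close>
    moreover have "xstar \<in> global_minimizers (l (\<xi> k))"
      using assms(12) i by blast
    ultimately show ?thesis
      unfolding assms(11) sgd.simps
      using assms(2,8,9) by (intro gradient_step_distance[OF _ assms(4)[OF i]]) auto
  qed
  have "(norm (x (n * (B + 1)) - xstar))\<^sup>2 - (norm (x (n * B) - xstar))\<^sup>2
      = (\<Sum>k = n * B..<n * (B + 1). (norm (x (Suc k) - xstar))\<^sup>2 - (norm (x k - xstar))\<^sup>2)"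
    by (rule sum_Suc_diff'[symmetric]) simp
  also have "\<dots> \<le> 2 * \<eta> * (\<Sum>k = n * B..<n * (B + 1).
      l (\<xi> k) (x k) - l (\<xi> k) xstar + (xstar - x k) \<bullet> grad (l (\<xi> k)) (x k))"
    unfolding sum_distrib_left by (rule sum_mono) (rule step)
  also have "\<dots> \<le> 0"
    using assms(8,13) unfolding epochwise_star_convex_path_def
    by (intro mult_nonneg_nonpos) auto
  finally have "(norm (x (n * (B + 1)) - xstar))\<^sup>2 \<le> (norm (x (n * B) - xstar))\<^sup>2"
    by linarith
  then show "norm (x (n * (B + 1)) - xstar) \<le> norm (x (n * B) - xstar)"
    by (rule power2_le_imp_le) (rule norm_ge_zero)
qed

end
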